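(* Let $k$ be a positive integer. Every Eulerian orientation of the hypercube $Q_{2k}$ of degree $2k$ is strongly $k$-node connected.
   Context: For a positive integer $d$, the hypercube $Q_d$ (of degree $d$) is the undirected $d$-regular graph whose $2^d$ nodes are the subsets of $\{1,2,\dots,d\}$, with an edge between two nodes whenever the two subsets differ in exactly one element (equivalently, binary strings of length $d$, adjacent when they differ in exactly one bit). An orientation of an undirected graph $G=(V,E)$ is a directed graph $D=(V,A)$ obtained by replacing each edge $\{v,w\}\in E$ by exactly one of the arcs $(v,w)$ or $(w,v)$. For a node $v$ of a directed graph, $d^{in}(v)$ is the number of arcs with head $v$ and $d^{out}(v)$ is the number of arcs with tail $v$. An orientation of a graph $G$ all of whose degrees are even is called Eulerian if $d^{in}(v)=d^{out}(v)$ for every $v\in V(G)$. A directed graph is called strongly $k$-node connected if it has at least $k+1$ nodes and the deletion of any set of at most $k-1$ nodes results in a strongly connected directed graph. *)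

theory Defs
  imports "Graph_Theory.Digraph_Component"
begin

text \<open>
  As is usual for \<^typ>\<open>'a pair_pre_digraph\<close>, a simple undirected graph is given by its
  symmetric loop-free arc relation (see \<^locale>\<open>pair_graph\<close>): an edge between \<open>v\<close> and \<open>w\<close> is
  the pair of arcs \<open>(v, w)\<close>, \<open>(w, v)\<close>, and the degree of \<open>v\<close> is its out-degree.
\<close>

definition hypercube :: "nat \<Rightarrow> nat set pair_pre_digraph" where
  "hypercube d =
     \<lparr> pverts = Pow {1..d},
       parcs = {(A, B). A \<subseteq> {1..d} \<and> B \<subseteq> {1..d} \<and> card ((A - B) \<union> (B - A)) = 1} \<rparr>"

definition orientation :: "'a pair_pre_digraph \<Rightarrow> 'a pair_pre_digraph \<Rightarrow> bool" where
  "orientation D G \<longleftrightarrow>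
     pverts D = pverts G \<and> parcs D \<subseteq> parcs G \<and>
     (\<forall>(v, w) \<in> parcs G. (v, w) \<in> parcs D \<longleftrightarrow> (w, v) \<notin> parcs D)"

definition eulerian_orientation :: "'a pair_pre_digraph \<Rightarrow> 'a pair_pre_digraph \<Rightarrow> bool" where
  "eulerian_orientation D G \<longleftrightarrow>
     (\<forall>v \<in> pverts G. even (out_degree (with_proj G) v)) \<and>
     orientation D G \<and>
     (\<forall>v \<in> pverts G. in_degree (with_proj D) v = out_degree (with_proj D) v)"

text \<open>
  ``At most \<open>k - 1\<close> nodes'' is written \<open>card X < k\<close> to avoid truncated subtraction.
  Since \<open>card\<close> is \<open>0\<close> on infinite sets, the first conjunct forces the node set to be finite.
\<close>

definition strongly_node_connected :: "nat \<Rightarrow> ('a, 'b) pre_digraph \<Rightarrow> bool" where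
  "strongly_node_connected k D \<longleftrightarrow>
     k + 1 \<le> card (verts D) \<and>
     (\<forall>X. X \<subseteq> verts D \<and> card X < k \<longrightarrow> strongly_connected (D \<restriction> (verts D - X)))"

lemma pair_graph_hypercube: "pair_graph (hypercube d)"
proof
  have "parcs (hypercube d) \<subseteq> Pow {1..d} \<times> Pow {1..d}"
    by (auto simp: hypercube_def)
  then show "finite (parcs (hypercube d))"
    by (rule finite_subset) auto
  show "symmetric (with_proj (hypercube d))"
    by (auto simp: symmetric_def sym_def arcs_ends_conv hypercube_def Un_commute)
qed (auto simp: hypercube_def)

lemma card_verts_hypercube: "card (pverts (hypercube d)) = 2 ^ d"
  by (simp add: hypercube_def card_Pow)

lemma out_degree_hypercube:
  assumes "A \<in> pverts (hypercube d)"
  shows "out_degree (with_proj (hypercube d)) A = d"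
proof -
  define f where "f i = (A, (A - {i}) \<union> ({i} - A))" for i
  have A: "A \<subseteq> {1..d}"
    using assms by (simp add: hypercube_def)
  have "out_arcs (with_proj (hypercube d)) A = f ` {1..d}"
  proof (intro equalityI subsetI)
    fix e assume "e \<in> out_arcs (with_proj (hypercube d)) A"
    then obtain B where e: "e = (A, B)" and B: "B \<subseteq> {1..d}"
      and c: "card ((A - B) \<union> (B - A)) = 1"
      by (auto simp: out_arcs_def hypercube_def)
    from c obtain i where i: "(A - B) \<union> (B - A) = {i}"
      by (rule card_1_singletonE)
    then have "i \<in> {1..d}" using A B by blast
    moreover have "B = (A - {i}) \<union> ({i} - A)" using i by blast
    ultimately show "e \<in> f ` {1..d}" by (auto simp: e f_def)
  next
    fix e assume "e \<in> f ` {1..d}"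
    then obtain i where i: "i \<in> {1..d}" "e = f i" by blast
    have "(A - snd (f i)) \<union> (snd (f i) - A) = {i}" by (auto simp: f_def)
    then have "card ((A - snd (f i)) \<union> (snd (f i) - A)) = 1" by simp
    moreover have "snd (f i) \<subseteq> {1..d}" "fst (f i) = A" using A i by (auto simp: f_def)
    ultimately show "e \<in> out_arcs (with_proj (hypercube d)) A"
      using A i by (cases "f i") (auto simp: out_arcs_def hypercube_def)
  qed
  moreover have "inj_on f {1..d}"
    by (rule inj_onI) (auto simp: f_def)
  ultimately show ?thesis
    by (simp add: out_degree_def card_image)
qed

end

theory Submission
  imports Defs "HOL-Analysis.Convex"
begin

text \<open>
  Suppose that deleting a set \<open>X\<close> of fewer than \<open>k\<close> nodes leaves a digraph that is not strongly
  connected. The remaining nodes then fall into nonempty parts \<open>S\<close> and \<open>T\<close> with no arc from \<open>S\<close>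
  to \<open>T\<close>. In an Eulerian orientation of the \<open>2k\<close>-regular hypercube every node has out-degree and
  in-degree \<open>k\<close>, so exactly \<open>k |S|\<close> arcs have their tail in \<open>S\<close>, and all of them have their head
  in \<open>S \<union> X\<close>. Reversing all arcs shows the same for \<open>T\<close>. One of \<open>S\<close> and \<open>T\<close> contains at most half
  of the \<open>4^k\<close> nodes, so it is enough to prove that such a small set cannot send all its arcs into
  itself and fewer than \<open>k\<close> further nodes. This is the content of \<open>card_arcs_into_few_less\<close>:
  if \<open>0 < 2 |S| \<le> 4^k\<close> and \<open>|X| < k\<close>, then fewer than \<open>k |S|\<close> arcs lead from \<open>S\<close> to \<open>S \<union> X\<close>.

  That bound mentions neither the dimension of the cube nor any degree condition, so it can be
  proved by induction on \<open>|S|\<close>. When \<open>|S|\<close> is large, \<open>4^(k-1) < 2 |S|\<close>, the set \<open>X\<close> is negligible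
  compared with \<open>S\<close>, and the edge-isoperimetric inequality of the cube applied to \<open>S \<union> X\<close> suffices
  (\<open>edge_isoperimetry\<close>, \<open>entropy_bound_large\<close>). A single node is the tail of at most \<open>|X|\<close> such
  arcs. In the remaining cases, cut the cube along a coordinate that separates two nodes of \<open>S\<close>.
  If \<open>X\<close> meets both halves, each half contains at most \<open>k - 2\<close> nodes of \<open>X\<close>; the induction hypothesis for \<open>k - 1\<close> gives less than \<open>k - 1\<close> arcs per node
  of \<open>S\<close> within the halves, and each node of \<open>S\<close> is the tail of at most one arc across the cut.
  If \<open>X\<close> misses a half, the nodes of \<open>S\<close> in that half span few arcs among themselves by the
  isoperimetric inequality and meet at most one arc across the cut each, while the other half is
  covered by the induction hypothesis for the same \<open>k\<close>.
\<close>

section \<open>Oriented subgraphs of the cube and coordinate cuts\<close>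

definition flip :: "'a \<Rightarrow> 'a set \<Rightarrow> 'a set" where
  "flip i u = (u - {i}) \<union> ({i} - u)"

definition side :: "'a \<Rightarrow> bool \<Rightarrow> 'a set set \<Rightarrow> 'a set set" where
  "side i c S = {u \<in> S. (i \<in> u) = c}"

definition crossing :: "'a \<Rightarrow> ('a set \<times> 'a set) set" where
  "crossing i = {(u, v). (i \<in> u) \<noteq> (i \<in> v)}"

text \<open>
  The arc sets of orientations of subgraphs of a cube, in any dimension: every edge joins two sets
  that differ in one element and carries at most one of its two arcs. Leaving the ground set open
  lets the inductions below run over vertex sets alone.
\<close>

definition flip_arcs :: "('a set \<times> 'a set) set \<Rightarrow> bool" where
  "flip_arcs A \<longleftrightarrow> (\<forall>(u, v) \<in> A. (v, u) \<notin> A \<and> (\<exists>i. v = flip i u))"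

lemma flip_flip: "flip i (flip i u) = u"
  by (auto simp: flip_def)

lemma flip_arcsD:
  assumes "flip_arcs A" "(u, v) \<in> A"
  shows "(v, u) \<notin> A" "\<exists>i. v = flip i u"
  using bspec[OF assms(1)[unfolded flip_arcs_def] assms(2)] by simp_all

lemma flip_arcs_converse:
  assumes A: "flip_arcs A"
  shows "flip_arcs (A\<inverse>)"
  unfolding flip_arcs_def
proof (rule ballI, rule case_prodI2)
  fix p u v assume "p \<in> A\<inverse>" "p = (u, v)"
  then have vu: "(v, u) \<in> A" by simp
  obtain i where "u = flip i v" using flip_arcsD(2)[OF A vu] by (elim exE)
  then have "v = flip i u" by (simp add: flip_flip)
  then have "\<exists>i. v = flip i u" by (rule exI)
  then show "(v, u) \<notin> A\<inverse> \<and> (\<exists>i. v = flip i u)" using flip_arcsD(1)[OF A vu] by simp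
qed

lemma flip_arcs_irrefl: "flip_arcs A \<Longrightarrow> (u, u) \<notin> A"
  using flip_arcsD(1) by metis

lemma crossing_flip:
  assumes "flip_arcs A" "(u, v) \<in> A" "(i \<in> u) \<noteq> (i \<in> v)"
  shows "v = flip i u"
proof -
  obtain j where "v = flip j u" using flip_arcsD(2)[OF assms(1,2)] by (elim exE)
  moreover from this have "j = i" using assms(3) by (auto simp: flip_def split: if_splits)
  ultimately show ?thesis by simp
qed

text \<open>
  The tail of an arc across coordinate \<open>i\<close> determines its head.
\<close>

lemma card_crossing_le_tails:
  assumes "flip_arcs A" "finite S"
  shows "card (A \<inter> S \<times> W \<inter> crossing i) \<le> card S"
proof (rule card_inj_on_le[where f = fst])
  show "inj_on fst (A \<inter> S \<times> W \<inter> crossing i)"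
  proof (rule inj_onI, clarify)
    fix u v u' v'
    assume a: "(u, v) \<in> A" "(u', v') \<in> A" "(u, v) \<in> crossing i" "(u', v') \<in> crossing i"
      and eq: "fst (u, v) = fst (u', v')"
    have "v = flip i u" "v' = flip i u'"
      using a crossing_flip[OF assms(1)] by (auto simp: crossing_def)
    then show "u = u' \<and> v = v'" using eq by simp
  qed
qed (use assms in auto)

text \<open>
  The edges across coordinate \<open>i\<close> form a perfect matching between the two halves of the cube, so
  each crossing edge is determined by its endpoint in one chosen half; as the arc set contains at
  most one arc of each edge, this endpoint determines the arc as well.
\<close>

lemma card_crossing_le_side:
  assumes A: "flip_arcs A" and P: "finite P"
    and sub: "side i c (S \<union> W) \<subseteq> P"
  shows "card (A \<inter> S \<times> W \<inter> crossing i) \<le> card P"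
proof (rule card_inj_on_le[OF _ _ P])
  let ?g = "\<lambda>(u, v). if (i \<in> u) = c then u else v"
  show "inj_on ?g (A \<inter> S \<times> W \<inter> crossing i)"
  proof (rule inj_onI, clarify)
    fix u v u' v'
    assume a: "(u, v) \<in> A" "(u', v') \<in> A" "(u, v) \<in> crossing i" "(u', v') \<in> crossing i"
      and eq: "(if (i \<in> u) = c then u else v) = (if (i \<in> u') = c then u' else v')"
    have v: "v = flip i u" "v' = flip i u'"
      using a crossing_flip[OF A] by (auto simp: crossing_def)
    have anti: "(v, u) \<notin> A" by (rule flip_arcsD(1)[OF A a(1)])
    have "u = u'"
    proof (cases "(i \<in> u) = c"; cases "(i \<in> u') = c")
      assume "(i \<in> u) = c" "(i \<in> u') \<noteq> c"
      then have "u = v'" using eq by simp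
      then have "v = u'" using v flip_flip[of i u'] by simp
      then show ?thesis using anti a(2) \<open>u = v'\<close> by simp
    next
      assume "(i \<in> u) \<noteq> c" "(i \<in> u') = c"
      then have "v = u'" using eq by simp
      then have "v' = u" using v flip_flip[of i u] by simp
      then show ?thesis using anti a(2) \<open>v = u'\<close> by simp
    next
      assume "(i \<in> u) \<noteq> c" "(i \<in> u') \<noteq> c"
      then show ?thesis using eq v flip_flip[of i] by metis
    qed (use eq in simp)
    then show "u = u' \<and> v = v'" using v by simp
  qed
  show "?g ` (A \<inter> S \<times> W \<inter> crossing i) \<subseteq> P"
  proof (clarify)
    fix u v assume "u \<in> S" "v \<in> W" "(u, v) \<in> crossing i"
    then show "(if (i \<in> u) = c then u else v) \<in> P"
      using sub by (cases "(i \<in> u) = c") (auto simp: side_def crossing_def)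
  qed
qed

lemma card_arcs_split:
  assumes "finite S" "finite W"
  shows "card (A \<inter> S \<times> W) = card (A \<inter> side i c S \<times> side i c W)
    + card (A \<inter> side i (\<not> c) S \<times> side i (\<not> c) W) + card (A \<inter> S \<times> W \<inter> crossing i)"
proof -
  let ?B = "\<lambda>c. A \<inter> side i c S \<times> side i c W"
  have fin: "finite (A \<inter> S \<times> W)" "finite (?B c)" "finite (?B (\<not> c))"
    using assms by (auto simp: side_def)
  have "A \<inter> S \<times> W = (?B c \<union> ?B (\<not> c)) \<union> (A \<inter> S \<times> W \<inter> crossing i)"
    by (auto simp: side_def crossing_def)
  also have "card \<dots> = card (?B c \<union> ?B (\<not> c)) + card (A \<inter> S \<times> W \<inter> crossing i)"
    using fin by (intro card_Un_disjoint) (auto simp: side_def crossing_def)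
  also have "card (?B c \<union> ?B (\<not> c)) = card (?B c) + card (?B (\<not> c))"
    using fin by (intro card_Un_disjoint) (auto simp: side_def)
  finally show ?thesis .
qed

lemma card_side: "finite S \<Longrightarrow> card (side i c S) + card (side i (\<not> c) S) = card S"
proof -
  assume "finite S"
  then have "card (side i c S \<union> side i (\<not> c) S) = card (side i c S) + card (side i (\<not> c) S)"
    by (intro card_Un_disjoint) (auto simp: side_def)
  moreover have "side i c S \<union> side i (\<not> c) S = S" by (auto simp: side_def)
  ultimately show ?thesis by simp
qed

lemma finite_side: "finite S \<Longrightarrow> finite (side i c S)"
  by (simp add: side_def)

lemma side_Un: "side i c (S \<union> W) = side i c S \<union> side i c W"
  by (auto simp: side_def)

lemma exists_splitting_coordinate:
  assumes "card S \<ge> 2"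
  obtains i where "\<And>c. side i c S \<noteq> {}"
proof -
  obtain u v where uv: "u \<in> S" "v \<in> S" "u \<noteq> v"
    using assms by (metis card_2_iff' ex_card subset_iff)
  then obtain i where "(i \<in> u) \<noteq> (i \<in> v)" by blast
  then have "side i c S \<noteq> {}" for c
    using uv by (cases c) (auto simp: side_def)
  then show ?thesis by (rule that)
qed

section \<open>The edge-isoperimetric inequality\<close>

text \<open>
  The inequality that drives the induction on coordinate cuts: \<open>a\<close> and \<open>b\<close> stand for the numbers
  of nodes in the two halves, and \<open>b\<close> bounds the number of edges between them. It splits into
  \<open>a log (1 + b/a) \<ge> b\<close>, which is concavity of the logarithm on \<open>[1, 2]\<close>, and
  \<open>b log ((a + b)/b) \<ge> b\<close>, which holds because \<open>a + b \<ge> 2b\<close>.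
\<close>

lemma xlogx_superadditive:
  fixes a b :: real
  assumes "0 < b" "b \<le> a"
  shows "a * log 2 a + b * log 2 b + 2 * b \<le> (a + b) * log 2 (a + b)"
proof -
  have t: "b / a \<le> log 2 (1 + b / a)"
  proof -
    define t where "t = b / a"
    have t: "0 \<le> t" "t \<le> 1" using assms by (auto simp: t_def)
    have "concave_on {0<..} (log (2::real))" by (rule log_concave) simp
    from concave_onD[OF this, of t 1 2] have "t \<le> log 2 (1 + t)" 
      using t by (simp add: algebra_simps)
    then show ?thesis by (simp add: t_def)
  qed
  have "log 2 (a + b) = log 2 a + log 2 (1 + b / a)"
  proof -
    have "a + b = a * (1 + b / a)" using assms by (simp add: field_simps)
    moreover have "log 2 (a * (1 + b / a)) = log 2 a + log 2 (1 + b / a)"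
      using assms add_pos_pos[of 1 "b / a"] by (simp add: log_mult)
    ultimately show ?thesis by simp
  qed
  then have 1: "a * log 2 a + b \<le> a * log 2 (a + b)"
    using t assms by (simp add: field_simps)
  have "log 2 (2 * b) \<le> log 2 (a + b)" using assms by simp
  then have "log 2 b + 1 \<le> log 2 (a + b)" using assms by (simp add: log_mult)
  then have "b * (log 2 b + 1) \<le> b * log 2 (a + b)" using assms by (intro mult_left_mono) auto
  with 1 show ?thesis by (simp add: algebra_simps)
qed

text \<open>
  A set of \<open>w\<close> nodes of a cube spans at most \<open>w log w / 2\<close> edges, with equality for subcubes.
  Cut along a coordinate that splits the set: every edge across the cut uses up a different node of
  the smaller part.
\<close>

lemma edge_isoperimetry:
  fixes A :: "('a set \<times> 'a set) set"
  assumes A: "flip_arcs A" and "finite W"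
  shows "2 * real (card (A \<inter> W \<times> W)) \<le> real (card W) * log 2 (real (card W))"
  using \<open>finite W\<close>
proof (induction "card W" arbitrary: W rule: less_induct)
  case less
  show ?case
  proof (cases "card W \<ge> 2")
    case False
    then have "card W = 0 \<or> card W = 1" by linarith
    then have "A \<inter> W \<times> W = {}"
      using less.prems flip_arcs_irrefl[OF A] by (auto simp: card_1_singleton_iff)
    then show ?thesis using False by (cases "card W") auto
  next
    case True
    then obtain i where ne: "\<And>c. side i c W \<noteq> {}" by (rule exists_splitting_coordinate) blast
    define c where "c \<longleftrightarrow> card (side i True W) \<le> card (side i False W)"
    let ?w = "\<lambda>c. card (side i c W)"
    have le: "?w c \<le> ?w (\<not> c)" by (cases c) (auto simp: c_def)
    have pos: "?w d > 0" for d using ne less.prems by (simp add: card_gt_0_iff finite_side)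
    note sum = card_side[OF less.prems, of i c]
    have IH: "2 * real (card (A \<inter> side i d W \<times> side i d W)) \<le> real (?w d) * log 2 (real (?w d))" for d
    proof (rule less.hyps)
      show "?w d < card W" using sum pos[of c] pos[of "\<not> c"] by (cases "d = c") auto
    qed (simp add: finite_side less.prems)
    have cr: "card (A \<inter> W \<times> W \<inter> crossing i) \<le> ?w c"
      by (rule card_crossing_le_side[OF A, where c = c]) (auto simp: finite_side less.prems)
    have "2 * real (card (A \<inter> W \<times> W)) \<le>
      real (?w (\<not> c)) * log 2 (real (?w (\<not> c))) + real (?w c) * log 2 (real (?w c)) + 2 * real (?w c)"
      unfolding card_arcs_split[OF less.prems less.prems, where i = i and c = c and A = A] using IH[of c] IH[of "\<not> c"] cr by simp
    also have "\<dots> \<le> (real (?w (\<not> c)) + real (?w c)) * log 2 (real (?w (\<not> c)) + real (?w c))"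
      using le pos by (intro xlogx_superadditive) auto
    also have "real (?w (\<not> c)) + real (?w c) = real (card W)" using sum by linarith
    finally show ?thesis .
  qed
qed

section \<open>Few arcs lead from a small set into itself and few other nodes\<close>

lemma quadratic_le_power4: "2 * (m + 1) * m \<le> 4 ^ m" for m :: nat
proof (induction m)
  case (Suc m)
  have "2 * (Suc m + 1) * Suc m \<le> 4 ^ Suc m" if "m \<le> 1"
    using that by (cases m) auto
  moreover have "2 * (Suc m + 1) * Suc m \<le> 4 * (2 * (m + 1) * m)" if "m > 1"
  proof -
    have "(m + 2) * (m + 1) \<le> (4 * m) * (m + 1)" using that by (intro mult_right_mono) auto
    then show ?thesis by (simp add: algebra_simps)
  qed
  ultimately show ?case using Suc by (cases "m \<le> 1") auto
qed simp

text \<open>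
  Here \<open>k = m + 1\<close>, \<open>s = |S|\<close> and \<open>x = |X|\<close>. With \<open>n = s + x\<close> the claim reads
  \<open>2 k x < n (2k - log n)\<close>. As \<open>2 k x \<le> 2 (m + 1) m \<le> 4^m\<close>, it is enough that the right-hand side
  exceeds \<open>q = 4^m\<close>. When \<open>n\<close> passes \<open>q\<close> and then \<open>2q\<close>, the factor \<open>2k - log n\<close> is still at least
  \<open>2\<close>, \<open>1\<close> and \<open>1/2\<close> in the three ranges, just enough for the lower bounds \<open>q/2\<close>, \<open>q\<close> and \<open>2q\<close> on \<open>n\<close>.
\<close>

lemma entropy_bound_large:
  fixes m s x :: nat
  assumes lo: "4 ^ m < 2 * s" and hi: "2 * s \<le> 4 ^ (m + 1)" and x: "x \<le> m"
  shows "real (s + x) * log 2 (real (s + x)) < 2 * (real m + 1) * real s"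
proof -
  define n q :: real where "n = real (s + x)" and "q = 4 ^ m"
  have q1: "q = 2 powr (2 * m)"
    by (simp add: q_def powr_powr[symmetric] powr_realpow)
  have "real (4 ^ m) < real (2 * s)" using lo by linarith
  then have n_lo: "q < 2 * n" by (simp add: n_def q_def)
  have "real (2 * s) \<le> real (4 ^ (m+1))" using hi by linarith
  then have s_hi: "real s \<le> 2 * q" by (simp add: q_def)
  have quad: "2 * (real m + 1) * real m \<le> q"
    using of_nat_mono[OF quadratic_le_power4[of m], where 'a = real] by (simp add: q_def algebra_simps)
  have n0: "n > 0" using n_lo by (simp add: q_def) (smt (verit) zero_le_power)
  have xq: "4 * real x \<le> q"
  proof (cases "m = 0")
    case False
    then have "4 * real m \<le> 2 * (real m + 1) * real m" by (simp add: algebra_simps)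
    then show ?thesis using quad x by linarith
  qed (use x in \<open>simp add: q_def\<close>)
  have logq: "log 2 (2 powr a * q) = a + 2 * m" for a
    by (simp add: q1 powr_add[symmetric])
  have log_le: "log 2 n \<le> a + 2 * m" if "n \<le> 2 powr a * q" for a
    using logq[of a] that n0 log_le_cancel_iff[of 2 n "2 powr a * q"] by (simp add: q1)
  have "q < n * (2 * (m + 1) - log 2 n)"
  proof -
    consider "n \<le> q" | "q < n" "n \<le> 2 * q" | "2 * q < n" by linarith
    then show ?thesis
    proof cases
      case 1
      then have "log 2 n \<le> 2 * m" using log_le[of 0] by simp
      then have "n * 2 \<le> n * (2 * (m + 1) - log 2 n)" using n0 by (intro mult_left_mono) auto
      then show ?thesis using n_lo by linarith
    next
      case 2
      then have "log 2 n \<le> 1 + 2 * m" using log_le[of 1] by simp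
      then have "n * 1 \<le> n * (2 * (m + 1) - log 2 n)" using n0 by (intro mult_left_mono) auto
      then show ?thesis using 2 by linarith
    next
      case 3
      \<comment> \<open>Since \<open>x\<close> is at most \<open>q/4\<close>, \<open>n\<close> exceeds \<open>2q\<close> by a factor of at most \<open>9/8\<close>, which is
        below the square root of \<open>2\<close>.\<close>
      have "4 * n \<le> 9 * q" using s_hi xq by (simp add: n_def)
      moreover have "9 / 4 \<le> (2::real) powr (3/2)"
      proof -
        have "(9/4)^2 \<le> ((2::real) powr (3/2))^2"
          by (simp add: powr_power) (simp add: power2_eq_square)
        then show ?thesis by (rule power2_le_imp_le) simp
      qed
      then have "9 / 4 * q \<le> 2 powr (3/2) * q" by (rule mult_right_mono) (simp add: q_def)
      ultimately have "log 2 n \<le> 3/2 + 2 * m" by (intro log_le) linarith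
      then have "n * (1/2) \<le> n * (2 * (m + 1) - log 2 n)" using n0 by (intro mult_left_mono) auto
      then show ?thesis using 3 by linarith
    qed
  qed
  moreover have "2 * (real m + 1) * real x \<le> 2 * (real m + 1) * real m"
    using x by (intro mult_left_mono) auto
  ultimately have "2 * (real m + 1) * real x < n * (2 * (m + 1) - log 2 n)"
    using quad by linarith
  then show ?thesis by (simp add: n_def algebra_simps)
qed

text \<open>
  A single node with \<open>k\<close> outgoing arcs shows that the condition on \<open>|X|\<close> cannot be relaxed. The
  condition on \<open>|S|\<close> says that \<open>S\<close> is at most half of the cube of dimension \<open>2k\<close>. If
  \<open>2 |S| \<le> 4^(k-1)\<close>, both parts of \<open>S\<close> satisfy it with \<open>k - 1\<close> in place of \<open>k\<close>, which the
  induction needs; the remaining range is the one treated by the isoperimetric inequality.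
\<close>

lemma card_arcs_into_few_less:
  fixes A :: "('a set \<times> 'a set) set"
  assumes A: "flip_arcs A"
    and "finite S" "finite X" "S \<noteq> {}" "2 * card S \<le> 4 ^ k" "card X < k"
  shows "card (A \<inter> S \<times> (S \<union> X)) < k * card S"
  using assms(2-)
proof (induction "card S" arbitrary: S X k rule: less_induct)
  case less
  note finS = \<open>finite S\<close> and finX = \<open>finite X\<close>
  obtain m where k: "k = m + 1" using less.prems by (cases k) auto
  have s0: "card S > 0" using less.prems by (simp add: card_gt_0_iff)
  consider (large) "4 ^ m < 2 * card S" | (single) "card S = 1"
    | (split) "2 * card S \<le> 4 ^ m" "card S \<ge> 2"
    using s0 by linarith
  then show ?case
  proof cases
    case large
    let ?W = "S \<union> X"
    have W: "card ?W \<le> card S + card X" by (rule card_Un_le)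
    have W1: "card ?W > 0" using less.prems by (simp add: card_gt_0_iff)
    have "2 * real (card (A \<inter> S \<times> ?W)) \<le> 2 * real (card (A \<inter> ?W \<times> ?W))"
      using finS finX by (intro mult_left_mono of_nat_mono card_mono) auto
    also have "\<dots> \<le> real (card ?W) * log 2 (real (card ?W))"
      using finS finX by (intro edge_isoperimetry A) auto
    also have "\<dots> \<le> real (card S + card X) * log 2 (real (card S + card X))"
      using W W1 by (intro mult_mono) auto
    also have "\<dots> < 2 * (real m + 1) * real (card S)"
      using large less.prems k by (intro entropy_bound_large) auto
    finally have "real (card (A \<inter> S \<times> ?W)) < real (k * card S)" by (simp add: k algebra_simps)
    then show ?thesis by linarith
  next
    case single
    then obtain u where u: "S = {u}" by (auto simp: card_1_singleton_iff)
    have "card (A \<inter> S \<times> (S \<union> X)) \<le> card X"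
      using finX flip_arcs_irrefl[OF A] by (intro card_inj_on_le[where f = snd]) (auto simp: u inj_on_def)
    then show ?thesis using less.prems single by simp
  next
    case split
    then obtain i where ne: "\<And>c. side i c S \<noteq> {}" by (elim exists_splitting_coordinate) blast
    let ?s = "\<lambda>c. card (side i c S)" and ?x = "\<lambda>c. card (side i c X)"
    let ?F = "\<lambda>c. card (A \<inter> side i c S \<times> (side i c S \<union> side i c X))"
    have pos: "?s d > 0" for d using ne finS by (simp add: card_gt_0_iff finite_side)
    have sum: "?s c + ?s (\<not> c) = card S" for c by (rule card_side[OF finS])
    have sumx: "?x c + ?x (\<not> c) = card X" for c by (rule card_side[OF finX])
    have lt: "?s c < card S" for c using sum[of c] pos[of "\<not> c"] by linarith
    have total: "card (A \<inter> S \<times> (S \<union> X)) = ?F c + ?F (\<not> c)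
        + card (A \<inter> S \<times> (S \<union> X) \<inter> crossing i)" for c
      using card_arcs_split[of S "S \<union> X" A i c] finS finX by (simp add: side_Un)
    show ?thesis
    proof (cases "\<exists>c. side i c X = {}")
      case True
      then obtain c where c: "side i c X = {}" by blast
      have "card (A \<inter> S \<times> (S \<union> X) \<inter> crossing i) \<le> ?s c"
        using c finS by (intro card_crossing_le_side[OF A, where c = c]) (auto simp: finite_side side_Un)
      \<comment> \<open>All of \<open>X\<close> may lie in the other half, so \<open>k\<close> stays the same there.\<close>
      moreover have "?F (\<not> c) < k * ?s (\<not> c)"
        using lt[of "\<not> c"] sumx[of c] less.prems ne finS finX
        by (intro less.hyps) (auto simp: finite_side)
      moreover have "?F c \<le> m * ?s c"
      proof -
        have "2 * real (?F c) \<le> real (?s c) * log 2 (real (?s c))"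
          using edge_isoperimetry[OF A, of "side i c S"] c finS by (simp add: finite_side)
        also have "\<dots> \<le> real (?s c) * (2 * real m)"
        proof (intro mult_left_mono)
          have "?s c \<le> 4 ^ m" using split lt[of c] by linarith
          then have "real (?s c) \<le> 4 ^ m" by (metis of_nat_le_iff of_nat_numeral of_nat_power)
          also have "\<dots> = 2 powr (2 * m)" by (simp add: powr_powr[symmetric] powr_realpow)
          finally show "log 2 (real (?s c)) \<le> 2 * real m"
            using pos[of c] by (subst log_le_iff) auto
        qed simp
        finally have "real (?F c) \<le> real (m * ?s c)" by (simp add: mult.commute)
        then show ?thesis by linarith
      qed
      ultimately have "card (A \<inter> S \<times> (S \<union> X)) < k * ?s (\<not> c) + m * ?s c + ?s c"
        using total[of c] by linarith
      also have "\<dots> = k * card S" by (simp add: k sum[of c, symmetric] algebra_simps)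
      finally show ?thesis .
    next
      case False
      then have xpos: "?x c > 0" for c using finX by (simp add: card_gt_0_iff finite_side)
      \<comment> \<open>Each half lacks a node of \<open>X\<close> that the other half has, which pays for the step to \<open>m = k - 1\<close>.\<close>
      have F: "?F c < m * ?s c" for c
        using lt[of c] sumx[of c] xpos[of "\<not> c"] less.prems split ne finS finX
        by (intro less.hyps) (auto simp: finite_side k)
      have "card (A \<inter> S \<times> (S \<union> X) \<inter> crossing i) \<le> card S"
        by (rule card_crossing_le_tails[OF A finS])
      then have "card (A \<inter> S \<times> (S \<union> X)) < m * ?s True + m * ?s False + card S"
        using total[of True] F[of True] F[of False] by simp
      also have "\<dots> = k * card S" using sum[of True] by (simp add: k algebra_simps flip: distrib_left)
      finally show ?thesis .
    qed
  qed
qed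

section \<open>Eulerian orientations of the hypercube\<close>

lemma flip_arcs_orientation:
  assumes "orientation D (hypercube d)"
  shows "flip_arcs (parcs D)"
  unfolding flip_arcs_def
proof (clarify)
  fix u v assume uv: "(u, v) \<in> parcs D"
  then have Q: "(u, v) \<in> parcs (hypercube d)" using assms by (auto simp: orientation_def)
  then have "card ((u - v) \<union> (v - u)) = 1" by (simp add: hypercube_def)
  then obtain i where i: "(u - v) \<union> (v - u) = {i}" by (rule card_1_singletonE)
  have "v = flip i u" unfolding flip_def using i by blast
  then show "(v, u) \<notin> parcs D \<and> (\<exists>i. v = flip i u)"
    using uv Q assms by (auto simp: orientation_def)
qed

text \<open>
  The edges at \<open>v\<close> are its outgoing arcs together with the reversals of its incoming ones, so the
  two equal degrees add up to \<open>2k\<close>.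
\<close>

lemma degree_eulerian_hypercube:
  assumes E: "eulerian_orientation D (hypercube (2 * k))" and v: "v \<in> pverts D"
  shows "out_degree (with_proj D) v = k" "in_degree (with_proj D) v = k"
proof -
  let ?Q = "hypercube (2 * k)"
  have O: "orientation D ?Q" and eq: "in_degree (with_proj D) v = out_degree (with_proj D) v"
    and vQ: "v \<in> pverts ?Q"
    using E v by (auto simp: eulerian_orientation_def orientation_def)
  have sym: "(a, b) \<in> parcs ?Q \<longleftrightarrow> (b, a) \<in> parcs ?Q" for a b
    by (auto simp: hypercube_def Un_commute)
  have "parcs D \<subseteq> Pow {1..2 * k} \<times> Pow {1..2 * k}"
    using O by (auto simp: orientation_def hypercube_def)
  then have fin: "finite (parcs D)" by (rule finite_subset) auto
  have "out_arcs (with_proj ?Q) v = out_arcs (with_proj D) v \<union> prod.swap ` in_arcs (with_proj D) v"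
    using O sym by (fastforce simp: orientation_def out_arcs_def in_arcs_def image_iff)
  moreover have "card (out_arcs (with_proj D) v \<union> prod.swap ` in_arcs (with_proj D) v)
      = out_degree (with_proj D) v + card (prod.swap ` in_arcs (with_proj D) v)"
    unfolding out_degree_def
  proof (rule card_Un_disjoint)
    show "out_arcs (with_proj D) v \<inter> prod.swap ` in_arcs (with_proj D) v = {}"
      using O by (fastforce simp: orientation_def out_arcs_def in_arcs_def)
  qed (use fin in \<open>auto simp: out_arcs_def in_arcs_def\<close>)
  moreover have "card (prod.swap ` in_arcs (with_proj D) v) = in_degree (with_proj D) v"
    unfolding in_degree_def by (intro card_image) simp
  ultimately have "out_degree (with_proj ?Q) v = out_degree (with_proj D) v + in_degree (with_proj D) v"
    by (simp add: out_degree_def)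
  then show "out_degree (with_proj D) v = k" "in_degree (with_proj D) v = k"
    using eq out_degree_hypercube[OF vQ] by simp_all
qed

lemma card_arcs_from:
  assumes "finite S" "\<And>u. u \<in> S \<Longrightarrow> card {e \<in> A. fst e = u} = k" "k > 0"
  shows "card (A \<inter> S \<times> UNIV) = k * card S"
proof -
  have "A \<inter> S \<times> UNIV = (\<Union>u\<in>S. {e \<in> A. fst e = u})" by auto
  also have "card \<dots> = (\<Sum>u\<in>S. card {e \<in> A. fst e = u})"
    using assms by (intro card_UN_disjoint) (auto intro: card_ge_0_finite)
  finally show ?thesis using assms by simp
qed

text \<open>
  The form in which the counting bound is used, for the orientation as well as for its reversal:
  a set that can only be left through fewer than \<open>k\<close> nodes occupies more than half of the cube of
  dimension \<open>2k\<close>.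
\<close>

lemma more_than_half_of_closed:
  assumes A: "flip_arcs A" and "finite S" "S \<noteq> {}" "finite X" "card X < k"
    and deg: "\<And>u. u \<in> S \<Longrightarrow> card {e \<in> A. fst e = u} = k"
    and closed: "A `` S \<subseteq> S \<union> X"
  shows "4 ^ k < 2 * card S"
proof (rule ccontr)
  assume "\<not> 4 ^ k < 2 * card S"
  then have "card (A \<inter> S \<times> (S \<union> X)) < k * card S"
    using assms by (intro card_arcs_into_few_less) auto
  moreover have "A \<inter> S \<times> (S \<union> X) = A \<inter> S \<times> UNIV" using closed by auto
  moreover have "card (A \<inter> S \<times> UNIV) = k * card S"
    using assms by (intro card_arcs_from) auto
  ultimately show False by simp
qed

theorem theorem7:
  fixes k :: nat and D :: "nat set pair_pre_digraph"
  assumes "k \<ge> 1"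
    and "eulerian_orientation D (hypercube (2 * k))"
  shows "strongly_node_connected k (with_proj D)"
  unfolding strongly_node_connected_def
proof (intro conjI allI impI; (elim conjE)?)
  have O: "orientation D (hypercube (2 * k))"
    using assms by (simp add: eulerian_orientation_def)
  have A: "flip_arcs (parcs D)" by (rule flip_arcs_orientation[OF O])
  have V: "pverts D = Pow {1..2 * k}" using O by (simp add: orientation_def hypercube_def)
  have finV: "finite (pverts D)" by (simp add: V)
  have cardV: "card (pverts D) = 4 ^ k" by (simp add: V card_Pow power_mult)
  have arcsV: "parcs D \<subseteq> pverts D \<times> pverts D"
    using O by (auto simp: orientation_def hypercube_def)
  have k4: "k < 4 ^ k" by (rule power_gt_expt) simp
  then show "k + 1 \<le> card (verts (with_proj D))" by (simp add: cardV)
  fix X assume X: "X \<subseteq> verts (with_proj D)" and xk: "card X < k"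
  then have finX: "finite X" using finV by (auto intro: finite_subset)
  let ?H = "with_proj D \<restriction> (verts (with_proj D) - X)"
  have ends: "arcs_ends ?H = parcs D \<inter> (pverts D - X) \<times> (pverts D - X)"
    by (force simp: arcs_ends_conv induce_subgraph_def)
  interpret H: wf_digraph ?H
    by unfold_locales (auto simp: induce_subgraph_def)
  show "strongly_connected ?H"
    unfolding strongly_connected_def
  proof (intro conjI ballI)
    show "verts ?H \<noteq> {}"
      using card_mono[OF finX, of "pverts D"] cardV k4 xk by auto
    fix u v assume u: "u \<in> verts ?H" and v: "v \<in> verts ?H"
    show "u \<rightarrow>\<^sup>*\<^bsub>?H\<^esub> v"
    proof (rule ccontr)
      assume not: "\<not> u \<rightarrow>\<^sup>*\<^bsub>?H\<^esub> v"
      define S where "S = {w \<in> pverts D - X. u \<rightarrow>\<^sup>*\<^bsub>?H\<^esub> w}"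
      define T where "T = pverts D - X - S"
      have ST: "S \<subseteq> pverts D" "T \<subseteq> pverts D" "S \<inter> T = {}" "u \<in> S" "v \<in> T"
        using u v not H.reachable_refl[of u] by (auto simp: S_def T_def)
      then have fin: "finite S" "finite T" using finV by (auto intro: finite_subset)
      have no_arc: False if "(a, b) \<in> parcs D" "a \<in> S" "b \<in> T" for a b
      proof -
        have "a \<rightarrow>\<^bsub>?H\<^esub> b" unfolding ends using that by (auto simp: S_def T_def)
        moreover have "u \<rightarrow>\<^sup>*\<^bsub>?H\<^esub> a" using that by (simp add: S_def)
        ultimately have "u \<rightarrow>\<^sup>*\<^bsub>?H\<^esub> b" by (rule H.reachable_adj_trans[rotated])
        then show False using that by (auto simp: S_def T_def)
      qed
      have "4 ^ k < 2 * card S"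
      proof (rule more_than_half_of_closed[OF A fin(1) _ finX xk])
        show "card {e \<in> parcs D. fst e = a} = k" if "a \<in> S" for a
          using degree_eulerian_hypercube(1)[OF assms(2), of a] that ST
          by (auto simp: out_degree_def out_arcs_def)
        show "parcs D `` S \<subseteq> S \<union> X" using no_arc arcsV by (force simp: T_def)
      qed (use ST in auto)
      moreover have "4 ^ k < 2 * card T"
      proof (rule more_than_half_of_closed[OF flip_arcs_converse[OF A] fin(2) _ finX xk])
        show "card {e \<in> (parcs D)\<inverse>. fst e = a} = k" if "a \<in> T" for a
        proof -
          have "{e \<in> (parcs D)\<inverse>. fst e = a} = prod.swap ` {e \<in> parcs D. snd e = a}"
            by force
          then show ?thesis
            using degree_eulerian_hypercube(2)[OF assms(2), of a] that ST
            by (auto simp: in_degree_def in_arcs_def card_image)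
        qed
        show "(parcs D)\<inverse> `` T \<subseteq> T \<union> X" using no_arc arcsV by (force simp: T_def)
      qed (use ST in auto)
      moreover have "card S + card T \<le> card (pverts D)"
        using ST fin finV by (subst card_Un_disjoint[symmetric]) (auto intro: card_mono)
      ultimately show False using cardV by linarith
    qed
  qed
qed

end
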